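(* Let $(X,d)$ be a noncompact proper metric space. Then the subpower Higson corona $\nu_P X$ is not locally connected at any point, and the Higson corona $\nu_H X$ is not locally connected at any point.
   Context: A metric space $(X,d)$ is proper if every closed ball $\{y\in X : d(x,y)\le r\}$, $x\in X$, $r>0$, is compact. Fix a base point $x_0\in X$ and write $|x|=d(x,x_0)$; $B_d(x,r)=\{y\in X : d(x,y)<r\}$. A (not necessarily continuous) function $s:\mathbb{R}_+\to\mathbb{R}_+$ on the set of positive real numbers is asymptotically subpower if for every $\alpha>0$ there is $t_0>0$ such that $s(t)<t^{\alpha}$ for all $t>t_0$. Let $\mathcal{P}$ be the set of all asymptotically subpower functions and $\mathcal{H}$ the set of all positive constant functions. Let $C^*(X)$ be the ring of bounded continuous real-valued functions on $X$. For $(K,\mathcal{K})\in\{(P,\mathcal{P}),(H,\mathcal{H})\}$ let $C_K(X)$ be the set of all $f\in C^*(X)$ such that for every $s\in\mathcal{K}$, $\lim_{|x|\to\infty}\operatorname{diam} f(B_d(x,s(|x|)))=0$, i.e. for every $s\in\mathcal K$ and $\varepsilon>0$ there is $r_0>0$ such that $\operatorname{diam} f(B_d(x,s(|x|)))<\varepsilon$ for all $x\in X$ with $|x|>r_0$. Each $C_K(X)$ is a closed subring of $C^*(X)$ which contains the constants and generates the topology of $X$. The subpower Higson compactification $h_P X$ (respectively the Higson compactification $h_H X$) is the unique (Hausdorff) compactification of $X$ associated with $C_P(X)$ (respectively $C_H(X)$); $h_K X$ is characterized by: a bounded continuous $f:X\to\mathbb{R}$ extends continuously to $h_K X$ if and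 only if $f\in C_K(X)$. The coronas are $\nu_P X=h_P X\setminus X$ and $\nu_H X=h_H X\setminus X$ with the subspace topologies. A topological space $Z$ is locally connected at $p\in Z$ if each neighborhood of $p$ contains a connected open neighborhood of $p$. *)

theory Defs
  imports "HOL-Analysis.Analysis"
begin

text \<open>The functions s from the positive reals to themselves are represented by total functions on
  the reals; their values at nonpositive arguments are unconstrained and never matter.\<close>

definition subpower_functions :: "(real \<Rightarrow> real) set" where
  "subpower_functions = {s. (\<forall>t>0. s t > 0) \<and> (\<forall>\<alpha>>0. \<exists>t\<^sub>0>0. \<forall>t>t\<^sub>0. s t < t powr \<alpha>)}"

definition constant_functions :: "(real \<Rightarrow> real) set" where
  "constant_functions = {s. \<exists>c>0. \<forall>t>0. s t = c}"

definition C_star :: "('a::metric_space \<Rightarrow> real) set" where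
  "C_star = {f. continuous_on UNIV f \<and> bounded (range f)}"

definition C_slow :: "'a::metric_space \<Rightarrow> (real \<Rightarrow> real) set \<Rightarrow> ('a \<Rightarrow> real) set" where
  "C_slow x\<^sub>0 K = {f \<in> C_star. \<forall>s\<in>K. \<forall>\<epsilon>>0. \<exists>r\<^sub>0>0. \<forall>x.
      dist x x\<^sub>0 > r\<^sub>0 \<longrightarrow> diameter (f ` ball x (s (dist x x\<^sub>0))) < \<epsilon>}"

definition compactification :: "('a::metric_space \<Rightarrow> 'b) \<Rightarrow> 'b topology \<Rightarrow> bool" where
  "compactification e Z \<longleftrightarrow> compact_space Z \<and> Hausdorff_space Z \<and>
     embedding_map euclidean Z e \<and> Z closure_of (range e) = topspace Z"

text \<open>A compactification associated with a ring C is determined, up to homeomorphism over the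
  space, by its defining property, so it is treated as a predicate on compactifications; the theorem
  \<open>associated_compactification_exists\<close> below shows that this predicate is satisfiable in the
  cases of interest.\<close>

definition associated_compactification ::
    "('a::metric_space \<Rightarrow> real) set \<Rightarrow> ('a \<Rightarrow> 'b) \<Rightarrow> 'b topology \<Rightarrow> bool" where
  "associated_compactification C e Z \<longleftrightarrow> compactification e Z \<and>
     (\<forall>f\<in>C_star. (\<exists>g. continuous_map Z euclideanreal g \<and> (\<forall>x. g (e x) = f x)) \<longleftrightarrow> f \<in> C)"

definition subpower_Higson_compactification ::
    "'a::metric_space \<Rightarrow> ('a \<Rightarrow> 'b) \<Rightarrow> 'b topology \<Rightarrow> bool" where
  "subpower_Higson_compactification x\<^sub>0 = associated_compactification (C_slow x\<^sub>0 subpower_functions)"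

definition Higson_compactification ::
    "'a::metric_space \<Rightarrow> ('a \<Rightarrow> 'b) \<Rightarrow> 'b topology \<Rightarrow> bool" where
  "Higson_compactification x\<^sub>0 = associated_compactification (C_slow x\<^sub>0 constant_functions)"

definition corona :: "('a \<Rightarrow> 'b) \<Rightarrow> 'b topology \<Rightarrow> 'b topology" where
  "corona e Z = subtopology Z (topspace Z - range e)"

lemma open_vimage_coordinate: "open U \<Longrightarrow> open {h :: 'a \<Rightarrow> 'b::topological_space. h a \<in> U}"
  using open_vimage[of U "\<lambda>h :: 'a \<Rightarrow> 'b. h a"] by (simp add: vimage_def)

instance "fun" :: (type, t0_space) t0_space
proof
  fix f g :: "'a \<Rightarrow> 'b" assume "f \<noteq> g"
  then obtain a where a: "f a \<noteq> g a" by auto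
  then obtain U where "open U" "\<not> (f a \<in> U \<longleftrightarrow> g a \<in> U)"
    using Topological_Spaces.t0_space_class.t0_space[OF a] by auto
  then show "\<exists>U. open U \<and> \<not> (f \<in> U \<longleftrightarrow> g \<in> U)"
    by (intro exI[of _ "{h. h a \<in> U}"]) (auto simp: open_vimage_coordinate)
qed

instance "fun" :: (type, t1_space) t1_space
proof
  fix f g :: "'a \<Rightarrow> 'b" assume "f \<noteq> g"
  then obtain a where a: "f a \<noteq> g a" by auto
  then obtain U where "open U" "f a \<in> U" "g a \<notin> U"
    using t1_space[OF a] by auto
  then show "\<exists>U. open U \<and> f \<in> U \<and> g \<notin> U"
    by (intro exI[of _ "{h. h a \<in> U}"]) (auto simp: open_vimage_coordinate)
qed

instance "fun" :: (type, t2_space) t2_space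
proof
  fix f g :: "'a \<Rightarrow> 'b" assume "f \<noteq> g"
  then obtain a where a: "f a \<noteq> g a" by auto
  then obtain U V where "open U" "open V" "f a \<in> U" "g a \<in> V" "U \<inter> V = {}"
    using hausdorff[OF a] by auto
  then show "\<exists>U V. open U \<and> open V \<and> f \<in> U \<and> g \<in> V \<and> U \<inter> V = {}"
    by (intro exI[of _ "{h. h a \<in> U}"] exI[of _ "{h. h a \<in> V}"])
      (auto simp: open_vimage_coordinate)
qed

lemma C_slow_iff:
  "f \<in> C_slow x\<^sub>0 K \<longleftrightarrow> f \<in> C_star \<and> (\<forall>s\<in>K. \<forall>\<epsilon>>0. \<exists>r\<^sub>0>0. \<forall>x. dist x x\<^sub>0 > r\<^sub>0 \<longrightarrow>
     (\<forall>y \<in> ball x (s (dist x x\<^sub>0)). \<forall>z \<in> ball x (s (dist x x\<^sub>0)). dist (f y) (f z) < \<epsilon>))"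
  (is "_ \<longleftrightarrow> _ \<and> ?R")
proof -
  have "(\<forall>s\<in>K. \<forall>\<epsilon>>0. \<exists>r\<^sub>0>0. \<forall>x. dist x x\<^sub>0 > r\<^sub>0 \<longrightarrow> diameter (f ` ball x (s (dist x x\<^sub>0))) < \<epsilon>) = ?R"
    (is "?L = _") if f: "f \<in> C_star"
  proof
    assume L: ?L
    show ?R
    proof (intro ballI allI impI)
      fix s and \<epsilon> :: real assume "s \<in> K" "\<epsilon> > 0"
      with L obtain r where r: "r > 0" "\<And>x. dist x x\<^sub>0 > r \<Longrightarrow> diameter (f ` ball x (s (dist x x\<^sub>0))) < \<epsilon>"
        by meson
      have "dist (f y) (f z) \<le> diameter (f ` ball x (s (dist x x\<^sub>0)))"
        if "y \<in> ball x (s (dist x x\<^sub>0))" "z \<in> ball x (s (dist x x\<^sub>0))" for x y z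
      proof (rule diameter_bounded_bound)
        show "bounded (f ` ball x (s (dist x x\<^sub>0)))"
          using f by (auto simp: C_star_def intro: bounded_subset)
      qed (use that in auto)
      then show "\<exists>r\<^sub>0>0. \<forall>x. dist x x\<^sub>0 > r\<^sub>0 \<longrightarrow>
          (\<forall>y \<in> ball x (s (dist x x\<^sub>0)). \<forall>z \<in> ball x (s (dist x x\<^sub>0)). dist (f y) (f z) < \<epsilon>)"
        using r by (meson le_less_trans)
    qed
  next
    assume R: ?R
    show ?L
    proof (intro ballI allI impI)
      fix s and \<epsilon> :: real assume "s \<in> K" "\<epsilon> > 0"
      with R obtain r where r: "r > 0" "\<And>x y z. dist x x\<^sub>0 > r \<Longrightarrow>
          y \<in> ball x (s (dist x x\<^sub>0)) \<Longrightarrow> z \<in> ball x (s (dist x x\<^sub>0)) \<Longrightarrow> dist (f y) (f z) < \<epsilon>/2"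
        by (meson half_gt_zero)
      have "diameter (f ` ball x (s (dist x x\<^sub>0))) < \<epsilon>" if x: "dist x x\<^sub>0 > r" for x
      proof -
        have "diameter (f ` ball x (s (dist x x\<^sub>0))) \<le> \<epsilon>/2"
        proof (rule diameter_le)
          show "norm (u - v) \<le> \<epsilon>/2"
            if "u \<in> f ` ball x (s (dist x x\<^sub>0))" "v \<in> f ` ball x (s (dist x x\<^sub>0))" for u v
            using that r(2)[OF x] unfolding dist_norm[symmetric] by (blast intro: less_imp_le)
        qed (use \<open>\<epsilon> > 0\<close> in auto)
        then show ?thesis using \<open>\<epsilon> > 0\<close> by linarith
      qed
      then show "\<exists>r\<^sub>0>0. \<forall>x. dist x x\<^sub>0 > r\<^sub>0 \<longrightarrow> diameter (f ` ball x (s (dist x x\<^sub>0))) < \<epsilon>"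
        using r(1) by blast
    qed
  qed
  then show ?thesis
    unfolding C_slow_def by blast
qed

lemma C_star_add: "f \<in> C_star \<Longrightarrow> g \<in> C_star \<Longrightarrow> (\<lambda>x. f x + g x) \<in> C_star"
  by (auto simp: C_star_def intro!: continuous_intros bounded_plus_comp)

lemma C_star_mult: "f \<in> C_star \<Longrightarrow> g \<in> C_star \<Longrightarrow> (\<lambda>x. f x * g x :: real) \<in> C_star"
proof -
  assume f: "f \<in> C_star" and g: "g \<in> C_star"
  obtain A B where A: "\<And>x. \<bar>f x\<bar> \<le> A" and B: "\<And>x. \<bar>g x\<bar> \<le> B"
    using f g by (auto simp: C_star_def bounded_iff)
  have "\<bar>f x * g x\<bar> \<le> A * B" for x
    unfolding abs_mult by (intro mult_mono A B) (use A[of x] in auto)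
  then show ?thesis
    using f g by (auto simp: C_star_def bounded_iff intro!: continuous_intros)
qed

lemma C_slow_const: "(\<lambda>_. c) \<in> C_slow x\<^sub>0 K"
  by (auto simp: C_slow_iff C_star_def intro!: exI[of _ "1::real"])

lemma C_slow_combine:
  assumes f: "f \<in> C_slow x\<^sub>0 K" and g: "g \<in> C_slow x\<^sub>0 K" and h: "h \<in> C_star"
    and le: "\<And>y z. \<bar>h y - h z\<bar> \<le> M * (\<bar>f y - f z\<bar> + \<bar>g y - g z\<bar>)" and M: "M > 0"
  shows "h \<in> C_slow x\<^sub>0 K"
  unfolding C_slow_iff
proof (intro conjI ballI allI impI)
  fix s and \<epsilon> :: real assume s: "s \<in> K" and e: "\<epsilon> > 0"
  define d where "d = \<epsilon> / (2 * M)"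
  have d: "d > 0" using e M by (simp add: d_def)
  obtain a where a: "a > 0" "\<And>x y z. dist x x\<^sub>0 > a \<Longrightarrow>
      y \<in> ball x (s (dist x x\<^sub>0)) \<Longrightarrow> z \<in> ball x (s (dist x x\<^sub>0)) \<Longrightarrow> dist (f y) (f z) < d"
    using f s d unfolding C_slow_iff by meson
  obtain b where b: "b > 0" "\<And>x y z. dist x x\<^sub>0 > b \<Longrightarrow>
      y \<in> ball x (s (dist x x\<^sub>0)) \<Longrightarrow> z \<in> ball x (s (dist x x\<^sub>0)) \<Longrightarrow> dist (g y) (g z) < d"
    using g s d unfolding C_slow_iff by meson
  have "dist (h y) (h z) < \<epsilon>" if "dist x x\<^sub>0 > max a b"
      "y \<in> ball x (s (dist x x\<^sub>0))" "z \<in> ball x (s (dist x x\<^sub>0))" for x y z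
  proof -
    have "\<bar>f y - f z\<bar> + \<bar>g y - g z\<bar> < d + d"
      using a(2)[of x y z] b(2)[of x y z] that by (simp add: dist_real_def)
    then have "M * (\<bar>f y - f z\<bar> + \<bar>g y - g z\<bar>) < M * (d + d)"
      using M by simp
    also have "M * (d + d) = \<epsilon>" using M by (simp add: d_def)
    finally show ?thesis using le[of y z] by (simp add: dist_real_def)
  qed
  then show "\<exists>r\<^sub>0>0. \<forall>x. dist x x\<^sub>0 > r\<^sub>0 \<longrightarrow>
      (\<forall>y \<in> ball x (s (dist x x\<^sub>0)). \<forall>z \<in> ball x (s (dist x x\<^sub>0)). dist (h y) (h z) < \<epsilon>)"
    using a(1) by (intro exI[of _ "max a b"]) auto
qed (rule h)

lemma C_slow_subset: "f \<in> C_slow x\<^sub>0 K \<Longrightarrow> f \<in> C_star"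
  by (simp add: C_slow_def)

lemma C_slow_add: "f \<in> C_slow x\<^sub>0 K \<Longrightarrow> g \<in> C_slow x\<^sub>0 K \<Longrightarrow> (\<lambda>x. f x + g x) \<in> C_slow x\<^sub>0 K"
  by (rule C_slow_combine[where M = 1 and f = f and g = g]) (auto intro: C_star_add C_slow_subset)

lemma C_slow_mult:
  assumes f: "f \<in> C_slow x\<^sub>0 K" and g: "g \<in> C_slow x\<^sub>0 K"
  shows "(\<lambda>x. f x * g x) \<in> C_slow x\<^sub>0 K"
proof -
  obtain A B where A: "\<And>x. \<bar>f x\<bar> \<le> A" and B: "\<And>x. \<bar>g x\<bar> \<le> B"
    using C_slow_subset[OF f] C_slow_subset[OF g] by (auto simp: C_star_def bounded_iff)
  have A0: "A \<ge> 0" and B0: "B \<ge> 0" using A[of x\<^sub>0] B[of x\<^sub>0] by auto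
  have "\<bar>f y * g y - f z * g z\<bar> \<le> (A + B + 1) * (\<bar>f y - f z\<bar> + \<bar>g y - g z\<bar>)" for y z
  proof -
    have "f y * g y - f z * g z = (f y - f z) * g y + f z * (g y - g z)"
      by (simp add: algebra_simps)
    then have "\<bar>f y * g y - f z * g z\<bar> \<le> \<bar>f y - f z\<bar> * \<bar>g y\<bar> + \<bar>f z\<bar> * \<bar>g y - g z\<bar>"
      by (metis abs_mult abs_triangle_ineq)
    also have "\<dots> \<le> \<bar>f y - f z\<bar> * (A + B + 1) + (A + B + 1) * \<bar>g y - g z\<bar>"
      using A[of z] B[of y] A0 B0 by (intro add_mono mult_mono) auto
    finally show ?thesis by (simp add: algebra_simps)
  qed
  then show ?thesis
    using A0 B0
    by (intro C_slow_combine[OF f g, where M = "A + B + 1"] C_star_mult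
        C_slow_subset[OF f] C_slow_subset[OF g]) auto
qed

lemma C_slow_closed:
  assumes h: "h \<in> C_star" and approx: "\<And>\<epsilon>. \<epsilon> > 0 \<Longrightarrow> \<exists>f \<in> C_slow x\<^sub>0 K. \<forall>x. \<bar>h x - f x\<bar> < \<epsilon>"
  shows "h \<in> C_slow x\<^sub>0 K"
  unfolding C_slow_iff
proof (intro conjI ballI allI impI)
  fix s and \<epsilon> :: real assume s: "s \<in> K" and e: "\<epsilon> > 0"
  then obtain f where f: "f \<in> C_slow x\<^sub>0 K" "\<And>x. \<bar>h x - f x\<bar> < \<epsilon>/3"
    using approx[of "\<epsilon>/3"] by auto
  have "\<epsilon>/3 > 0" using e by simp
  then obtain a where a: "a > 0" "\<And>x y z. dist x x\<^sub>0 > a \<Longrightarrow>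
      y \<in> ball x (s (dist x x\<^sub>0)) \<Longrightarrow> z \<in> ball x (s (dist x x\<^sub>0)) \<Longrightarrow> dist (f y) (f z) < \<epsilon>/3"
    using f(1) s unfolding C_slow_iff by meson
  have "dist (h y) (h z) < \<epsilon>" if "dist x x\<^sub>0 > a"
      "y \<in> ball x (s (dist x x\<^sub>0))" "z \<in> ball x (s (dist x x\<^sub>0))" for x y z
    using a(2)[OF that] f(2)[of y] f(2)[of z] unfolding dist_real_def by linarith
  with a(1) show "\<exists>r\<^sub>0>0. \<forall>x. dist x x\<^sub>0 > r\<^sub>0 \<longrightarrow>
      (\<forall>y \<in> ball x (s (dist x x\<^sub>0)). \<forall>z \<in> ball x (s (dist x x\<^sub>0)). dist (h y) (h z) < \<epsilon>)"
    by (intro exI[of _ a]) simp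
qed (rule h)

lemma constant_functions_subset: "constant_functions \<subseteq> subpower_functions"
proof
  fix s assume "s \<in> constant_functions"
  then obtain c where c: "c > 0" "\<And>t. t > 0 \<Longrightarrow> s t = c" by (auto simp: constant_functions_def)
  have "\<exists>t\<^sub>0>0. \<forall>t>t\<^sub>0. s t < t powr \<alpha>" if "\<alpha> > 0" for \<alpha>
  proof (intro exI[of _ "c powr (1/\<alpha>)"] conjI allI impI)
    fix t assume "t > c powr (1/\<alpha>)"
    then have "(c powr (1/\<alpha>)) powr \<alpha> < t powr \<alpha>"
      using that by (intro powr_less_mono2) auto
    moreover have "t > 0" using \<open>t > _\<close> powr_gt_zero[of c "1/\<alpha>"] c(1) by linarith
    ultimately show "s t < t powr \<alpha>" using that c by (simp add: powr_powr)
  qed (use c in auto)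
  then show "s \<in> subpower_functions" using c by (auto simp: subpower_functions_def)
qed

lemma C_slow_bump:
  assumes "K \<subseteq> subpower_functions" and h: "h \<in> C_star"
    and supp: "\<And>x. dist x x\<^sub>0 > R \<Longrightarrow> h x = 0"
  shows "h \<in> C_slow x\<^sub>0 K"
  unfolding C_slow_iff
proof (intro conjI ballI allI impI)
  fix s and \<epsilon> :: real assume "s \<in> K" and e: "\<epsilon> > 0"
  then have "s \<in> subpower_functions" using assms(1) by auto
  then obtain t where t: "t > 0" "\<And>u. u > t \<Longrightarrow> s u < u powr (1/2)"
    unfolding subpower_functions_def by (smt (verit) mem_Collect_eq half_gt_zero)
  define r where "r = max t (max 4 (2 * R))"
  have "h y = 0" if x: "dist x x\<^sub>0 > r" and y: "y \<in> ball x (s (dist x x\<^sub>0))" for x y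
  proof -
    define u where "u = dist x x\<^sub>0"
    have u: "u > t" "u > 4" "u > 2 * R" using x by (auto simp: r_def u_def)
    have "sqrt u \<le> u / 2"
      using u(2) by (intro real_le_lsqrt) (auto simp: power2_eq_square field_simps)
    then have "s u < u / 2" using t(2)[OF u(1)] u(2) by (simp add: powr_half_sqrt)
    then have "dist y x\<^sub>0 > R"
      using y u dist_triangle[of x x\<^sub>0 y] by (simp add: u_def)
    then show ?thesis by (rule supp)
  qed
  then show "\<exists>r\<^sub>0>0. \<forall>x. dist x x\<^sub>0 > r\<^sub>0 \<longrightarrow>
      (\<forall>y \<in> ball x (s (dist x x\<^sub>0)). \<forall>z \<in> ball x (s (dist x x\<^sub>0)). dist (h y) (h z) < \<epsilon>)"
    using e t(1) by (intro exI[of _ r]) (auto simp: r_def)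
qed (rule h)

lemma C_slow_separates:
  assumes "K \<subseteq> subpower_functions" and "open U" "a \<in> U"
  shows "\<exists>h \<in> C_slow x\<^sub>0 K. h a > 0 \<and> (\<forall>x. h x > 0 \<longrightarrow> x \<in> U)"
proof -
  obtain d where d: "d > 0" "ball a d \<subseteq> U" using assms openE by blast
  define h where "h x = max 0 (d - dist a x)" for x
  have "continuous_on UNIV h" unfolding h_def by (intro continuous_intros)
  moreover have "bounded (range h)"
    unfolding bounded_iff using d by (intro exI[of _ d]) (auto simp: h_def)
  ultimately have "h \<in> C_star" by (simp add: C_star_def)
  moreover have "h x = 0" if "dist x x\<^sub>0 > d + dist a x\<^sub>0" for x
    using that dist_triangle[of x x\<^sub>0 a] by (simp add: h_def dist_commute)
  ultimately have "h \<in> C_slow x\<^sub>0 K" using C_slow_bump assms(1) by blast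
  moreover have "h a > 0" "h x > 0 \<Longrightarrow> x \<in> U" for x
    using d by (auto simp: h_def subset_iff)
  ultimately show ?thesis by blast
qed

text \<open>The witness is the closure of the image of the space under the evaluation map into the
  product of copies of the real line indexed by the ring.\<close>

theorem associated_compactification_exists:
  fixes x\<^sub>0 :: "'a::metric_space"
  assumes K: "K \<subseteq> subpower_functions"
  shows "\<exists>(e :: 'a \<Rightarrow> ('a \<Rightarrow> real) \<Rightarrow> real) Z. associated_compactification (C_slow x\<^sub>0 K) e Z"
proof -
  define C where "C = C_slow x\<^sub>0 K"
  define e :: "'a \<Rightarrow> ('a \<Rightarrow> real) \<Rightarrow> real" where "e = (\<lambda>x f. if f \<in> C then f x else 0)"
  define S where "S = closure (range e)"
  define Z where "Z = top_of_set S"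
  have bnd: "bounded (range f)" and cont: "continuous_on UNIV f" if "f \<in> C" for f
    using that C_slow_subset unfolding C_def C_star_def by blast+
  have "\<exists>B. \<forall>x. \<bar>e x f\<bar> \<le> B" for f
  proof (cases "f \<in> C")
    case True
    then show ?thesis using bnd[OF True] by (auto simp: e_def bounded_iff)
  qed (auto simp: e_def)
  then obtain B where B: "\<And>x f. \<bar>e x f\<bar> \<le> B f" by metis
  define P where "P = (\<Pi>\<^sub>E f\<in>UNIV. {- B f..B f})"
  have "compact P"
    using compactin_PiE[of "\<lambda>_::'a \<Rightarrow> real. euclideanreal" UNIV "\<lambda>f. {- B f..B f}"]
    by (simp add: P_def euclidean_product_topology)
  moreover have eP: "range e \<subseteq> P"
  proof
    fix p assume "p \<in> range e"
    then obtain x where "p = e x" by auto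
    then show "p \<in> P" using B[of x] by (auto simp: P_def abs_le_iff minus_le_iff)
  qed
  ultimately have compS: "compact S"
    unfolding S_def using compact_closure bounded_subset
    by (metis closure_minimal compact_Int_closed closed_closure compact_imp_closed inf.absorb2)
  have eS: "e x \<in> S" for x unfolding S_def by (rule subsetD[OF closure_subset]) simp
  have conte: "continuous_on UNIV e"
  proof (rule continuous_on_coordinatewise_then_product)
    fix f show "continuous_on UNIV (\<lambda>x. e x f)"
      using cont by (cases "f \<in> C") (auto simp: e_def)
  qed
  have coord: "continuous_on A (\<lambda>p::('a \<Rightarrow> real) \<Rightarrow> real. p f)" for A f
    by (rule continuous_on_subset[OF continuous_on_product_coordinates]) auto
  have inje: "inj e"
  proof (rule injI, rule ccontr)
    fix x y assume xy: "e x = e y" "x \<noteq> y"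
    then obtain h where "h \<in> C" "h x > 0" "\<forall>z. h z > 0 \<longrightarrow> z \<in> - {y}"
      using C_slow_separates[OF K, of "- {y}" x x\<^sub>0] by (auto simp: C_def)
    then show False using fun_cong[OF xy(1), of h] by (auto simp: e_def)
  qed
  have openmap: "openin (top_of_set (range e)) (e ` U)" if U: "open U" for U
  proof (subst openin_subopen, intro ballI)
    fix p assume "p \<in> e ` U"
    then obtain a where a: "a \<in> U" "p = e a" by auto
    obtain h where h: "h \<in> C" "h a > 0" "\<forall>z. h z > 0 \<longrightarrow> z \<in> U"
      using C_slow_separates[OF K U a(1), of x\<^sub>0] by (auto simp: C_def)
    have op: "open {q::('a \<Rightarrow> real) \<Rightarrow> real. q h > 0}"
      by (intro open_Collect_less continuous_intros coord)
    show "\<exists>T. openin (top_of_set (range e)) T \<and> p \<in> T \<and> T \<subseteq> e ` U"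
      by (rule exI[of _ "range e \<inter> {q. q h > 0}"])
        (use op h a in \<open>auto simp: e_def intro: openin_open_Int\<close>)
  qed
  have top: "topspace Z = S" by (simp add: Z_def)
  have sub: "subtopology Z (range e) = top_of_set (range e)"
    using eS by (simp add: Z_def subtopology_subtopology image_subset_iff inf.absorb2)
  have "homeomorphic_map euclidean (top_of_set (range e)) e"
  proof (rule bijective_open_imp_homeomorphic_map)
    show "continuous_map euclidean (top_of_set (range e)) e"
      using conte by (simp add: continuous_map_in_subtopology)
    show "open_map euclidean (top_of_set (range e)) e"
      using openmap by (auto simp: open_map_def)
  qed (use inje in auto)
  then have "embedding_map euclidean Z e"
    by (simp add: embedding_map_def sub)
  moreover have "Z closure_of (range e) = topspace Z"
    unfolding top using eS by (auto simp: Z_def closure_of_subtopology S_def inf.absorb2 image_subset_iff)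
  moreover have "compact_space Z"
    using compS by (simp add: Z_def compact_space_subtopology)
  moreover have "Hausdorff_space Z"
    unfolding Z_def euclidean_product_topology[symmetric]
    by (intro Hausdorff_space_subtopology) (simp add: Hausdorff_space_product_topology)
  ultimately have "compactification e Z" by (simp add: compactification_def)
  moreover have "(\<exists>g. continuous_map Z euclideanreal g \<and> (\<forall>x. g (e x) = f x)) \<longleftrightarrow> f \<in> C"
    if f: "f \<in> C_star" for f
  proof
    assume "f \<in> C"
    then show "\<exists>g. continuous_map Z euclideanreal g \<and> (\<forall>x. g (e x) = f x)"
      by (intro exI[of _ "\<lambda>p. p f"]) (auto simp: Z_def e_def coord)
  next
    assume "\<exists>g. continuous_map Z euclideanreal g \<and> (\<forall>x. g (e x) = f x)"
    then obtain g where g: "continuous_on S g" "\<And>x. g (e x) = f x"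
      by (auto simp: Z_def)
    define R where "R = {g. continuous_on S g \<and> (\<lambda>x. g (e x)) \<in> C}"
    have off: "p h = 0" if "p \<in> S" "h \<notin> C" for p h
    proof -
      have "closed {q::('a \<Rightarrow> real) \<Rightarrow> real. q h = 0}"
        by (intro closed_Collect_eq continuous_intros coord)
      then have "S \<subseteq> {q. q h = 0}"
        unfolding S_def by (rule closure_minimal[rotated]) (use that in \<open>auto simp: e_def\<close>)
      then show ?thesis using that by auto
    qed
    interpret function_ring_on R S
    proof
      fix p q assume pq: "p \<in> S" "q \<in> S" "p \<noteq> q"
      then obtain h where h: "p h \<noteq> q h" by auto
      with off pq have "h \<in> C" by metis
      then have "(\<lambda>r. r h) \<in> R" by (auto simp: R_def coord e_def)
      with h show "\<exists>f\<in>R. f p \<noteq> f q" by (intro bexI[of _ "\<lambda>r. r h"])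
    next
      fix g h assume "g \<in> R" "h \<in> R"
      then have g: "continuous_on S g" "(\<lambda>x. g (e x)) \<in> C_slow x\<^sub>0 K"
        and h: "continuous_on S h" "(\<lambda>x. h (e x)) \<in> C_slow x\<^sub>0 K"
        by (simp_all add: R_def C_def)
      show "(\<lambda>x. g x + h x) \<in> R" "(\<lambda>x. g x * h x) \<in> R"
        unfolding R_def C_def using C_slow_add[OF g(2) h(2)] C_slow_mult[OF g(2) h(2)]
        by (simp_all add: continuous_on_add continuous_on_mult g(1) h(1))
    next
      show "(\<lambda>_. c) \<in> R" for c by (simp add: R_def C_def C_slow_const)
    qed (simp_all add: R_def compS)
    show "f \<in> C" unfolding C_def
    proof (rule C_slow_closed[OF f])
      fix \<epsilon> :: real assume "\<epsilon> > 0"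
      from Stone_Weierstrass_basic[OF g(1) this]
      obtain k where "k \<in> R" "\<forall>x\<in>S. \<bar>g x - k x\<bar> < \<epsilon>" by blast
      then show "\<exists>k\<in>C_slow x\<^sub>0 K. \<forall>x. \<bar>f x - k x\<bar> < \<epsilon>"
        using eS by (intro bexI[of _ "\<lambda>x. k (e x)"]) (auto simp: R_def C_def simp flip: g(2))
    qed
  qed
  ultimately have "associated_compactification (C_slow x\<^sub>0 K) e Z"
    by (simp add: associated_compactification_def C_def)
  then show ?thesis by blast
qed

corollary subpower_Higson_compactification_exists:
  "\<exists>(e :: 'a::metric_space \<Rightarrow> ('a \<Rightarrow> real) \<Rightarrow> real) Z. subpower_Higson_compactification x\<^sub>0 e Z"
  unfolding subpower_Higson_compactification_def
  by (rule associated_compactification_exists) simp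

corollary Higson_compactification_exists:
  "\<exists>(e :: 'a::metric_space \<Rightarrow> ('a \<Rightarrow> real) \<Rightarrow> real) Z. Higson_compactification x\<^sub>0 e Z"
  unfolding Higson_compactification_def
  by (rule associated_compactification_exists) (rule constant_functions_subset)

end

theory Submission
  imports Defs
begin

text \<open>
  For \<open>|x| > 4\<close> the function \<open>f x = \<theta> + ln (1 + |x|)\<close> varies by at most \<open>4 / sqrt |x|\<close> on the ball
  of radius \<open>sqrt |x|\<close> around \<open>x\<close>, so \<open>G \<circ> f\<close> belongs to both rings for every bounded Lipschitz function \<open>G\<close> on the
  line, and extends to the compactification. Since \<open>f\<close> tends to infinity, \<open>G\<close> may have entirely
  unrelated values on widely separated intervals of the line, and this is what disconnects
  neighbourhoods.

  Let \<open>p\<close> be a point of the corona and \<open>T y\<close> the distance from \<open>y\<close> to the nearest integer. With one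
  of the two phases \<open>\<theta> = 0\<close> and \<open>\<theta> = 1/2\<close> the extension of \<open>T \<circ> f\<close> is less than \<open>1/3\<close> at \<open>p\<close>;
  let \<open>U\<close> be the open set where it is less than \<open>1/3\<close>. The trace of \<open>U\<close> on the space is a
  union of bands, on each of which \<open>f\<close> is within \<open>1/3\<close> of a fixed integer, and distinct bands have
  \<open>f\<close>-values at least \<open>1/3\<close> apart. A neighbourhood \<open>V \<subseteq> U\<close> of \<open>p\<close> contains the closure of a smaller
  open neighbourhood \<open>W\<close>. The trace of \<open>W\<close> is unbounded, whereas a band is bounded; so \<open>W\<close> meets
  infinitely many bands. Split their indices into two infinite sets \<open>A\<close> and \<open>B\<close>, and let \<open>G\<close> be a
  Lipschitz function that is 1 on the intervals with index in \<open>A\<close> and 0 on the others (lemma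
  \<open>band_indicator_exists\<close>). By density the extension of \<open>G \<circ> f\<close> has no values on \<open>V\<close> other than 0
  and 1. The points of \<open>W\<close> in the bands of either family form an unbounded set, which clusters in the
  corona (lemma \<open>unbounded_clusters_in_corona\<close>), so both values are attained at points of the
  corona in \<open>V\<close>. Hence the part of \<open>V\<close> in the corona is disconnected.
\<close>

section \<open>Lipschitz functions of the logarithm of the norm\<close>

definition shifted_log :: "'a::metric_space \<Rightarrow> real \<Rightarrow> 'a \<Rightarrow> real" where
  "shifted_log x\<^sub>0 \<theta> x = \<theta> + ln (1 + dist x x\<^sub>0)"

lemma ln_diff_near_sqrt:
  fixes a b t :: real
  assumes t: "t > 4" and a: "\<bar>a - t\<bar> \<le> sqrt t" and b: "\<bar>b - t\<bar> \<le> sqrt t"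
  shows "\<bar>ln (1 + a) - ln (1 + b)\<bar> \<le> 4 / sqrt t"
proof -
  have s: "sqrt t * 2 \<le> t"
    using t real_sqrt_le_mono[of 4 t] mult_right_mono[of 2 "sqrt t" "sqrt t"] by simp
  have one: "ln (1 + u) - ln (1 + v) \<le> 4 / sqrt t"
    if u: "\<bar>u - t\<bar> \<le> sqrt t" and v: "\<bar>v - t\<bar> \<le> sqrt t" for u v
  proof -
    have "t / 2 \<le> 1 + v" "0 < 1 + u" and uv: "u - v \<le> 2 * sqrt t"
      using u v s t by linarith+
    then have "ln (1 + u) - ln (1 + v) \<le> (u - v) / (1 + v)"
      using ln_diff_le[of "1 + u" "1 + v"] t by simp
    also have "\<dots> \<le> (2 * sqrt t) / (1 + v)"
      using uv \<open>t / 2 \<le> 1 + v\<close> t by (intro divide_right_mono) auto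
    also have "\<dots> \<le> (2 * sqrt t) / (t / 2)"
      using \<open>t / 2 \<le> 1 + v\<close> t by (intro divide_left_mono) auto
    also have "\<dots> = 4 / sqrt t"
      using t by (simp add: field_simps)
    finally show ?thesis .
  qed
  show ?thesis using one[OF a b] one[OF b a] by linarith
qed

text \<open>Asymptotically subpower functions are eventually smaller than the square root, and balls of
  radius \<open>sqrt |x|\<close> are too small for the logarithm of the norm to notice.\<close>

lemma Lipschitz_of_shifted_log_in_C_slow:
  fixes x\<^sub>0 :: "'a::metric_space" and G :: "real \<Rightarrow> real"
  assumes K: "K \<subseteq> subpower_functions"
    and lip: "\<And>y z. \<bar>G y - G z\<bar> \<le> L * \<bar>y - z\<bar>" and bnd: "\<And>y. \<bar>G y\<bar> \<le> M" and L: "L > 0"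
  shows "(\<lambda>x. G (shifted_log x\<^sub>0 \<theta> x)) \<in> C_slow x\<^sub>0 K"
  unfolding C_slow_iff
proof (intro conjI ballI allI impI)
  have "L-lipschitz_on UNIV G"
    using lip L by (auto simp: lipschitz_on_def dist_real_def)
  then have "continuous_on UNIV G"
    by (rule lipschitz_on_continuous_on)
  moreover have "1 + dist x x\<^sub>0 \<noteq> 0" for x
    by (metis add_pos_nonneg less_irrefl zero_le_dist zero_less_one)
  then have "continuous_on UNIV (shifted_log x\<^sub>0 \<theta>)"
    unfolding shifted_log_def by (intro continuous_intros) auto
  ultimately have "continuous_on UNIV (\<lambda>x. G (shifted_log x\<^sub>0 \<theta> x))"
    by (metis continuous_on_compose2 subset_UNIV)
  then show "(\<lambda>x. G (shifted_log x\<^sub>0 \<theta> x)) \<in> C_star"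
    using bnd by (auto simp: C_star_def bounded_iff)
next
  fix s and \<epsilon> :: real assume "s \<in> K" and e: "\<epsilon> > 0"
  then have "s \<in> subpower_functions" using K by auto
  then obtain t where t: "t > 0" "\<And>u. u > t \<Longrightarrow> s u < u powr (1/2)"
    unfolding subpower_functions_def by (smt (verit) mem_Collect_eq half_gt_zero)
  define r where "r = max t (max 4 ((4 * L / \<epsilon>)\<^sup>2))"
  have "dist (G (shifted_log x\<^sub>0 \<theta> y)) (G (shifted_log x\<^sub>0 \<theta> z)) < \<epsilon>"
    if x: "dist x x\<^sub>0 > r" and y: "y \<in> ball x (s (dist x x\<^sub>0))" and z: "z \<in> ball x (s (dist x x\<^sub>0))"
    for x y z
  proof -
    define u where "u = dist x x\<^sub>0"
    have u: "u > t" "u > 4" "u > (4 * L / \<epsilon>)\<^sup>2" using x by (auto simp: r_def u_def)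
    have su: "s u < sqrt u" using t(2)[OF u(1)] u(2) by (simp add: powr_half_sqrt)
    have near: "\<bar>dist w x\<^sub>0 - u\<bar> \<le> sqrt u" if "w \<in> ball x (s (dist x x\<^sub>0))" for w
      using that su dist_triangle[of x x\<^sub>0 w] dist_triangle[of w x\<^sub>0 x]
      by (simp add: u_def dist_commute)
    have "\<bar>shifted_log x\<^sub>0 \<theta> y - shifted_log x\<^sub>0 \<theta> z\<bar> \<le> 4 / sqrt u"
      using ln_diff_near_sqrt[OF u(2) near[OF y] near[OF z]] by (simp add: shifted_log_def)
    then have "L * \<bar>shifted_log x\<^sub>0 \<theta> y - shifted_log x\<^sub>0 \<theta> z\<bar> \<le> L * (4 / sqrt u)"
      using L by (intro mult_left_mono) auto
    then have "dist (G (shifted_log x\<^sub>0 \<theta> y)) (G (shifted_log x\<^sub>0 \<theta> z)) \<le> L * (4 / sqrt u)"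
      using lip[of "shifted_log x\<^sub>0 \<theta> y" "shifted_log x\<^sub>0 \<theta> z"]
      unfolding dist_real_def by linarith
    also have "\<dots> < \<epsilon>"
    proof -
      have "4 * L / \<epsilon> < sqrt u" by (rule real_less_rsqrt) (rule u(3))
      then show ?thesis using e u(2) by (simp add: field_simps)
    qed
    finally show ?thesis .
  qed
  then show "\<exists>r\<^sub>0>0. \<forall>x. dist x x\<^sub>0 > r\<^sub>0 \<longrightarrow>
      (\<forall>y \<in> ball x (s (dist x x\<^sub>0)). \<forall>z \<in> ball x (s (dist x x\<^sub>0)).
        dist (G (shifted_log x\<^sub>0 \<theta> y)) (G (shifted_log x\<^sub>0 \<theta> z)) < \<epsilon>)"
    using t(1) by (intro exI[of _ r]) (auto simp: r_def)
qed

section \<open>Bands around the integers\<close>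

definition dist_to_int :: "real \<Rightarrow> real" where
  "dist_to_int y = \<bar>y - of_int (round y)\<bar>"

lemma dist_to_int_le_half: "dist_to_int y \<le> 1/2"
  using of_int_round_abs_le[of y] by (simp add: dist_to_int_def abs_minus_commute)

lemma dist_to_int_Lipschitz: "\<bar>dist_to_int y - dist_to_int z\<bar> \<le> \<bar>y - z\<bar>"
proof -
  have "dist_to_int u \<le> dist_to_int v + \<bar>u - v\<bar>" for u v
    using round_diff_minimal[of u "round v"] unfolding dist_to_int_def by linarith
  from this[of y z] this[of z y] show ?thesis by linarith
qed

lemma dist_to_int_half_shift: "dist_to_int y \<le> 1/4 \<or> dist_to_int (1/2 + y) \<le> 1/4"
proof (rule ccontr)
  assume "\<not> ?thesis"
  then have *: "\<bar>y - of_int n\<bar> > 1/4" "\<bar>1/2 + y - of_int n\<bar> > 1/4" for n :: int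
    using round_diff_minimal[of y n] round_diff_minimal[of "1/2 + y" n]
    unfolding dist_to_int_def by linarith+
  show False
    using *(1)[of "round y"] *(2)[of "round y"] *(2)[of "round y + 1"] of_int_round_abs_le[of y]
    by (auto simp: abs_if split: if_splits)
qed

text \<open>The intervals of radius \<open>1/3\<close> around distinct integers are at distance at least \<open>1/3\<close>; this
  is the source of the Lipschitz constant.\<close>

lemma band_indicator_exists:
  fixes A :: "int set"
  obtains G :: "real \<Rightarrow> real" where
    "\<And>y z. \<bar>G y - G z\<bar> \<le> 3 * \<bar>y - z\<bar>" "\<And>y. \<bar>G y\<bar> \<le> 1"
    "\<And>y. dist_to_int y < 1/3 \<Longrightarrow> G y = (if round y \<in> A then 1 else 0)"
proof -
  define Y where "Y = {y. dist_to_int y < 1/3 \<and> round y \<notin> A}"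
  show ?thesis
  proof (cases "Y = {}")
    case True
    show ?thesis by (rule that[of "\<lambda>_. 1"]) (use True in \<open>auto simp: Y_def\<close>)
  next
    case False
    define G where "G y = min 1 (3 * infdist y Y)" for y
    show ?thesis
    proof (rule that)
      show "\<bar>G y - G z\<bar> \<le> 3 * \<bar>y - z\<bar>" for y z
        using infdist_triangle_abs[of y Y z] unfolding G_def dist_real_def
        by (auto simp: min_def abs_if split: if_splits)
      show "\<bar>G y\<bar> \<le> 1" for y
        using infdist_nonneg[of y Y] unfolding G_def by linarith
      show "G y = (if round y \<in> A then 1 else 0)" if y: "dist_to_int y < 1/3" for y
      proof (cases "round y \<in> A")
        case True
        have "1/3 \<le> dist y z" if z: "z \<in> Y" for z
        proof -
          from z True have "round y \<noteq> round z" by (auto simp: Y_def)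
          then have "\<bar>round y - round z\<bar> \<ge> 1" by linarith
          then have "\<bar>real_of_int (round y) - of_int (round z)\<bar> \<ge> 1" by linarith
          moreover have "\<bar>y - of_int (round y)\<bar> < 1/3" "\<bar>z - of_int (round z)\<bar> < 1/3"
            using y z by (simp_all add: Y_def dist_to_int_def)
          ultimately show ?thesis unfolding dist_real_def by linarith
        qed
        then have "1/3 \<le> infdist y Y"
          unfolding infdist_notempty[OF False] by (intro cINF_greatest False)
        then show ?thesis using True by (simp add: G_def)
      next
        case notA: False
        then have "y \<in> Y" using y by (simp add: Y_def)
        then show ?thesis using notA by (simp add: G_def)
      qed
    qed
  qed
qed

section \<open>Unbounded sets and the corona\<close>

lemma open_meets_dense_image:
  assumes "compactification e Z" and "openin Z W" and "W \<noteq> {}"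
  shows "\<exists>x. e x \<in> W"
proof -
  have "Z closure_of (range e) = topspace Z"
    using assms(1) by (simp add: compactification_def)
  then have "range e \<inter> W \<noteq> {}"
    using assms(2,3) by (simp add: dense_intersects_open)
  then show ?thesis by blast
qed

lemma compactin_embedding_iff:
  assumes "compactification e Z"
  shows "compactin Z (e ` D) \<longleftrightarrow> compact D"
proof -
  have "homeomorphic_map euclidean (subtopology Z (range e)) e"
    using assms by (simp add: compactification_def embedding_map_def)
  then have "compactin (subtopology Z (range e)) (e ` D) \<longleftrightarrow> compactin euclidean D"
    by (intro homeomorphic_map_compactness) auto
  then show ?thesis by (auto simp: compactin_subtopology)
qed

text \<open>A bounded trace would lie in a closed ball, whose image is compact and hence closed; removing
  that image from the neighbourhood would leave a nonempty open set that the dense space misses.\<close>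

lemma corona_neighbourhood_unbounded:
  fixes e :: "'a::metric_space \<Rightarrow> 'b"
  assumes comp: "compactification e Z" and proper: "\<And>(x::'a) r. r > 0 \<Longrightarrow> compact (cball x r)"
    and W: "openin Z W" "p \<in> W" and p: "p \<notin> range e"
  shows "\<not> bounded {x. e x \<in> W}"
proof
  assume "bounded {x. e x \<in> W}"
  then obtain a R' where "\<And>x. e x \<in> W \<Longrightarrow> dist a x \<le> R'" unfolding bounded_def by blast
  then obtain R where R: "R > 0" "{x. e x \<in> W} \<subseteq> cball a R"
    by (intro that[of "max 1 R'"]) (auto simp: le_max_iff_disj)
  have "compactin Z (e ` cball a R)"
    using proper[OF R(1)] by (simp add: compactin_embedding_iff[OF comp])
  then have "closedin Z (e ` cball a R)"
    using comp by (simp add: compactification_def compactin_imp_closedin)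
  then have "openin Z (W - e ` cball a R)"
    using W by (simp add: openin_diff)
  moreover have "p \<in> W - e ` cball a R" using W p by auto
  ultimately obtain x where "e x \<in> W - e ` cball a R"
    using open_meets_dense_image[OF comp, of "W - e ` cball a R"] by auto
  with R(2) show False by blast
qed

text \<open>If the closure of the image stayed inside the space, it would be compact, and the set
  bounded.\<close>

lemma unbounded_clusters_in_corona:
  fixes e :: "'a::metric_space \<Rightarrow> 'b"
  assumes comp: "compactification e Z" and S: "\<not> bounded S"
  shows "\<exists>q \<in> topspace Z - range e. q \<in> Z closure_of (e ` S)"
proof (rule ccontr)
  assume neg: "\<not> ?thesis"
  define C where "C = Z closure_of (e ` S)"
  have "C \<subseteq> topspace Z" unfolding C_def by (rule closure_of_subset_topspace)
  then have C: "C \<subseteq> range e" using neg unfolding C_def[symmetric] by blast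
  have "closedin Z C" unfolding C_def by (rule closedin_closure_of)
  then have "compactin Z C"
    using comp by (simp add: compactification_def closedin_compact_space)
  moreover have "e ` (e -` C) = C"
    unfolding image_vimage_eq using C by (rule Int_absorb2)
  ultimately have "compactin Z (e ` (e -` C))"
    by (simp only:)
  then have "compact (e -` C)"
    by (simp only: compactin_embedding_iff[OF comp])
  then have bdd: "bounded (e -` C)"
    by (rule compact_imp_bounded)
  have "e ` topspace euclidean = topspace (subtopology Z (range e))"
    using comp
    by (intro homeomorphic_imp_surjective_map) (simp add: compactification_def embedding_map_def)
  then have "e ` S \<subseteq> topspace Z" by auto
  then have "e ` S \<subseteq> C"
    unfolding C_def by (rule closure_of_subset)
  then have "S \<subseteq> e -` C"
    by (simp only: image_subset_iff_subset_vimage)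
  with bdd have "bounded S" by (rule bounded_subset)
  with S show False ..
qed

lemma continuous_map_closure_value:
  assumes "continuous_map Z euclideanreal g" and "closed F"
    and "\<And>x. x \<in> S \<Longrightarrow> g (e x) \<in> F" and "q \<in> Z closure_of (e ` S)"
  shows "g q \<in> F"
proof -
  have "g ` (Z closure_of (e ` S)) \<subseteq> euclideanreal closure_of (g ` e ` S)"
    by (rule continuous_map_image_closure_subset[OF assms(1)])
  also have "\<dots> \<subseteq> F"
    using assms(2,3) by (intro closure_of_minimal) auto
  finally show ?thesis using assms(4) by blast
qed

lemma C_slow_extends:
  assumes "associated_compactification (C_slow x\<^sub>0 K) e Z" and "h \<in> C_slow x\<^sub>0 K"
  shows "\<exists>g. continuous_map Z euclideanreal g \<and> (\<forall>x. g (e x) = h x)"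
  using assms(1)[unfolded associated_compactification_def, THEN conjunct2, rule_format,
      OF C_slow_subset[OF assms(2)]] assms(2) by simp

section \<open>Failure of local connectedness\<close>

text \<open>The phases 0 and \<open>1/2\<close> have distances to the integers with sum \<open>1/2\<close> at every point of the
  space, so they cannot both exceed \<open>1/4\<close> on a nonempty open set. One of them therefore keeps the
  logarithm away from the half-integers near \<open>p\<close>, where the index of the band jumps.\<close>

lemma phase_exists:
  fixes x\<^sub>0 :: "'a::metric_space"
  assumes K: "K \<subseteq> subpower_functions" and assoc: "associated_compactification (C_slow x\<^sub>0 K) e Z"
    and p: "p \<in> topspace Z"
  obtains \<theta> T where "continuous_map Z euclideanreal T"
    "\<And>x. T (e x) = dist_to_int (shifted_log x\<^sub>0 \<theta> x)" "T p < 1/3"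
proof -
  have comp: "compactification e Z" using assoc by (simp add: associated_compactification_def)
  have "\<exists>T. continuous_map Z euclideanreal T \<and> (\<forall>x. T (e x) = dist_to_int (shifted_log x\<^sub>0 \<theta> x))"
    for \<theta>
  proof -
    have "(\<lambda>x. dist_to_int (shifted_log x\<^sub>0 \<theta> x)) \<in> C_slow x\<^sub>0 K"
      using dist_to_int_Lipschitz dist_to_int_le_half
      by (intro Lipschitz_of_shifted_log_in_C_slow[OF K, where L = 1 and M = "1/2"])
        (auto simp: dist_to_int_def)
    then show ?thesis by (rule C_slow_extends[OF assoc])
  qed
  then obtain T where cont: "\<And>\<theta>. continuous_map Z euclideanreal (T \<theta>)"
    and T: "\<And>\<theta> x. T \<theta> (e x) = dist_to_int (shifted_log x\<^sub>0 \<theta> x)"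
    by metis
  have "T 0 p < 1/3 \<or> T (1/2) p < 1/3"
  proof (rule ccontr)
    assume "\<not> ?thesis"
    then have big: "T 0 p > 1/4" "T (1/2) p > 1/4" by auto
    define W where "W = {q \<in> topspace Z. T 0 q > 1/4} \<inter> {q \<in> topspace Z. T (1/2) q > 1/4}"
    have "openin Z {q \<in> topspace Z. T \<theta> q \<in> {1/4<..}}" for \<theta>
      by (rule openin_continuous_map_preimage[OF cont]) auto
    then have "openin Z W" unfolding W_def by (intro openin_Int) simp_all
    moreover have "p \<in> W" using p big by (simp add: W_def)
    ultimately obtain x where "e x \<in> W" using open_meets_dense_image[OF comp] by blast
    then show False
      using dist_to_int_half_shift[of "ln (1 + dist x x\<^sub>0)"]
      by (auto simp: W_def T shifted_log_def)
  qed
  then show ?thesis using that[OF cont T] by blast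
qed

text \<open>The logarithm of the norm is bounded on bounded sets only. So the trace of a
  neighbourhood of a corona point meets infinitely many bands, and each infinite family of bands
  that it meets accounts for an unbounded part of it.\<close>

lemma finite_bands_iff_bounded:
  "finite ((\<lambda>x. round (shifted_log x\<^sub>0 \<theta> x)) ` S) \<longleftrightarrow> bounded S"
proof
  assume "finite ((\<lambda>x. round (shifted_log x\<^sub>0 \<theta> x)) ` S)"
  then have "bdd_above ((\<lambda>x. round (shifted_log x\<^sub>0 \<theta> x)) ` S)"
    by (rule bdd_above_finite)
  then obtain m where m: "\<And>x. x \<in> S \<Longrightarrow> round (shifted_log x\<^sub>0 \<theta> x) \<le> m"
    by (auto simp: bdd_above_def)
  have "dist x\<^sub>0 x \<le> exp (of_int m + 1/2 - \<theta>)" if x: "x \<in> S" for x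
  proof -
    have "shifted_log x\<^sub>0 \<theta> x \<le> of_int m + 1/2"
      using m[OF x] of_int_round_ge[of "shifted_log x\<^sub>0 \<theta> x"] by linarith
    then have "ln (1 + dist x x\<^sub>0) \<le> of_int m + 1/2 - \<theta>" by (simp add: shifted_log_def)
    then have "1 + dist x x\<^sub>0 \<le> exp (of_int m + 1/2 - \<theta>)"
      by (metis add_pos_nonneg exp_le_cancel_iff exp_ln zero_le_dist zero_less_one)
    then show ?thesis by (simp add: dist_commute)
  qed
  then show "bounded S" unfolding bounded_def by blast
next
  assume "bounded S"
  then obtain R where R: "\<And>x. x \<in> S \<Longrightarrow> dist x x\<^sub>0 \<le> R"
    unfolding bounded_any_center[of S x\<^sub>0] by (auto simp: dist_commute)
  have "round (shifted_log x\<^sub>0 \<theta> x) \<in> {round \<theta>..round (\<theta> + ln (1 + R))}" if "x \<in> S" for x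
  proof -
    have d: "0 \<le> dist x x\<^sub>0" "dist x x\<^sub>0 \<le> R" using R[OF that] by auto
    then have "1 + dist x x\<^sub>0 > 0" "1 + R > 0" by linarith+
    with d have "0 \<le> ln (1 + dist x x\<^sub>0)" "ln (1 + dist x x\<^sub>0) \<le> ln (1 + R)"
      by simp_all
    then show ?thesis by (auto simp: shifted_log_def intro!: round_mono)
  qed
  then show "finite ((\<lambda>x. round (shifted_log x\<^sub>0 \<theta> x)) ` S)"
    by (intro finite_subset[OF _ finite_atLeastAtMost_int]) blast
qed

text \<open>The rings of both compactifications are covered, since the positive constants are
  asymptotically subpower.\<close>

theorem corona_not_locally_connected_at:
  fixes x\<^sub>0 :: "'a::metric_space" and e :: "'a \<Rightarrow> 'b"
  assumes K: "K \<subseteq> subpower_functions" and assoc: "associated_compactification (C_slow x\<^sub>0 K) e Z"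
    and proper: "\<And>(x::'a) r. r > 0 \<Longrightarrow> compact (cball x r)"
    and p: "p \<in> topspace (corona e Z)"
  shows "\<not> locally_connected_at p (corona e Z)"
proof
  assume lc: "locally_connected_at p (corona e Z)"
  have comp: "compactification e Z" using assoc by (simp add: associated_compactification_def)
  have topc: "topspace (corona e Z) = topspace Z - range e" by (auto simp: corona_def)
  with p have pZ: "p \<in> topspace Z" "p \<notin> range e" by auto
  obtain \<theta> T where T: "continuous_map Z euclideanreal T"
      "\<And>x. T (e x) = dist_to_int (shifted_log x\<^sub>0 \<theta> x)" "T p < 1/3"
    using phase_exists[OF K assoc pZ(1)] by metis
  define f where "f = shifted_log x\<^sub>0 \<theta>"
  define U where "U = {q \<in> topspace Z. T q \<in> {..<1/3}}"
  have opU: "openin Z U" unfolding U_def by (rule openin_continuous_map_preimage[OF T(1)]) auto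
  have pU: "p \<in> U" using T(3) pZ by (simp add: U_def)
  have "openin (corona e Z) ((topspace Z - range e) \<inter> U)"
    unfolding corona_def by (rule openin_subtopology_Int2[OF opU])
  then obtain O1 V where O1: "openin (corona e Z) O1" "p \<in> O1" "O1 \<subseteq> V"
      and V: "connectedin (corona e Z) V" "V \<subseteq> (topspace Z - range e) \<inter> U"
    using lc pZ pU unfolding locally_connected_at_def neighbourhood_base_at_def
    by (metis (no_types, lifting) Diff_iff IntI)
  then obtain W where W: "openin Z W" "O1 = W \<inter> (topspace Z - range e)"
    unfolding corona_def openin_subtopology by blast
  \<comment> \<open>Cluster points of the trace of \<open>W'\<close> in the corona must stay in \<open>V\<close>, so the closure of \<open>W'\<close> is
    kept inside \<open>W\<close>.\<close>
  have "regular_space Z"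
    using comp by (simp add: compactification_def compact_Hausdorff_imp_regular_space)
  moreover have "openin Z (W \<inter> U)" using W opU by blast
  then have "closedin Z (topspace Z - W \<inter> U)" by blast
  moreover have "p \<in> topspace Z - (topspace Z - W \<inter> U)" using O1 W pU pZ by blast
  ultimately obtain W' where W': "openin Z W'" "p \<in> W'"
      and disj: "disjnt (topspace Z - W \<inter> U) (Z closure_of W')"
    unfolding regular_space by blast
  have clW': "Z closure_of W' \<subseteq> W \<inter> U"
    using disj closure_of_subset_topspace[of Z W'] by (auto simp: disjnt_iff)
  define S where "S = {x. e x \<in> W'}"
  have "infinite ((\<lambda>x. round (f x)) ` S)"
    using corona_neighbourhood_unbounded[OF comp proper W' pZ(2)]
    by (simp add: f_def S_def finite_bands_iff_bounded)
  then obtain A B where AB: "A \<subseteq> (\<lambda>x. round (f x)) ` S" "B \<subseteq> (\<lambda>x. round (f x)) ` S"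
      "infinite A" "infinite B" "A \<inter> B = {}"
    by (rule infinite_split)
  obtain G :: "real \<Rightarrow> real" where G: "\<And>y z. \<bar>G y - G z\<bar> \<le> 3 * \<bar>y - z\<bar>" "\<And>y. \<bar>G y\<bar> \<le> 1"
      "\<And>y. dist_to_int y < 1/3 \<Longrightarrow> G y = (if round y \<in> A then 1 else 0)"
    using band_indicator_exists[of A] by metis
  have "(\<lambda>x. G (f x)) \<in> C_slow x\<^sub>0 K"
    unfolding f_def by (rule Lipschitz_of_shifted_log_in_C_slow[OF K G(1,2)]) simp
  then obtain g where g: "continuous_map Z euclideanreal g" "\<And>x. g (e x) = G (f x)"
    using C_slow_extends[OF assoc] by metis
  have gU: "g (e x) = (if round (f x) \<in> A then 1 else 0)" if "e x \<in> U" for x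
    using that G(3)[of "f x"] by (simp add: U_def T(2) g(2) f_def)
  have two_valued: "g ` V \<subseteq> {0, 1}"
  proof (intro image_subsetI)
    fix q assume "q \<in> V"
    then have q: "q \<in> U" "q \<in> topspace Z" using V by auto
    have "Z closure_of (range e) = topspace Z" using comp by (simp add: compactification_def)
    with q have "q \<in> Z closure_of (U \<inter> range e)"
      using openin_Int_closure_of_subset[OF opU, of "range e"] by blast
    moreover have "U \<inter> range e = e ` {x. e x \<in> U}" by auto
    ultimately have cl: "q \<in> Z closure_of (e ` {x. e x \<in> U})" by simp
    show "g q \<in> {0, 1}"
      by (rule continuous_map_closure_value[OF g(1) _ _ cl]) (simp_all add: gU)
  qed
  have attained: "c \<in> g ` V" if D: "infinite D" "D \<subseteq> (\<lambda>x. round (f x)) ` S"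
    and c: "\<And>n. n \<in> D \<Longrightarrow> c = (if n \<in> A then 1 else 0)" for D c
  proof -
    define SD where "SD = {x \<in> S. round (f x) \<in> D}"
    have "\<not> bounded SD"
    proof
      assume "bounded SD"
      then have "finite ((\<lambda>x. round (f x)) ` SD)"
        by (simp add: f_def finite_bands_iff_bounded)
      moreover have "D \<subseteq> (\<lambda>x. round (f x)) ` SD" using D(2) by (auto simp: SD_def)
      ultimately show False using D(1) finite_subset by blast
    qed
    then obtain q where q: "q \<in> topspace Z - range e" "q \<in> Z closure_of (e ` SD)"
      using unbounded_clusters_in_corona[OF comp] by blast
    have "e ` SD \<subseteq> W'" by (auto simp: SD_def S_def)
    then have "q \<in> Z closure_of W'" using q(2) closure_of_mono by blast
    then have "q \<in> V" using clW' q(1) W(2) O1(3) by blast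
    have "W' \<subseteq> U" using clW' closure_of_subset[of W' Z] openin_subset[OF W'(1)] by blast
    then have "g (e x) \<in> {c}" if "x \<in> SD" for x
      using that gU[of x] c[of "round (f x)"] by (auto simp: SD_def S_def)
    then have "g q \<in> {c}"
      by (rule continuous_map_closure_value[OF g(1) closed_singleton _ q(2)])
    then show ?thesis using \<open>q \<in> V\<close> by blast
  qed
  have "1 \<in> g ` V" "0 \<in> g ` V"
    by (rule attained[OF AB(3,1)], simp) (rule attained[OF AB(4,2)], use AB(5) in auto)
  moreover have "connected (g ` V)"
  proof -
    have "connectedin Z V" using V(1) by (simp add: corona_def connectedin_subtopology)
    then show ?thesis using connectedin_continuous_map_image[OF g(1)] by simp
  qed
  ultimately have "1/2 \<in> g ` V"
    using connectedD_interval[of "g ` V" 0 1 "1/2"] by simp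
  with two_valued show False by auto
qed

theorem mainTheorem2:
  fixes x\<^sub>0 :: "'a::metric_space"
    and e\<^sub>P :: "'a \<Rightarrow> 'b" and hP :: "'b topology"
    and e\<^sub>H :: "'a \<Rightarrow> 'c" and hH :: "'c topology"
  assumes proper: "\<And>(x::'a) r. r > 0 \<Longrightarrow> compact (cball x r)"
    and noncompact: "\<not> compact (UNIV :: 'a set)"
  shows "(subpower_Higson_compactification x\<^sub>0 e\<^sub>P hP \<longrightarrow>
            (\<forall>p \<in> topspace (corona e\<^sub>P hP). \<not> locally_connected_at p (corona e\<^sub>P hP)))
       \<and> (Higson_compactification x\<^sub>0 e\<^sub>H hH \<longrightarrow>
            (\<forall>p \<in> topspace (corona e\<^sub>H hH). \<not> locally_connected_at p (corona e\<^sub>H hH)))"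
proof (intro conjI impI ballI)
  fix p assume "subpower_Higson_compactification x\<^sub>0 e\<^sub>P hP"
  then have *: "associated_compactification (C_slow x\<^sub>0 subpower_functions) e\<^sub>P hP"
    by (simp only: subpower_Higson_compactification_def)
  assume p: "p \<in> topspace (corona e\<^sub>P hP)"
  show "\<not> locally_connected_at p (corona e\<^sub>P hP)"
    by (rule corona_not_locally_connected_at[OF order_refl * _ p]) (rule proper)
next
  fix p assume "Higson_compactification x\<^sub>0 e\<^sub>H hH"
  then have *: "associated_compactification (C_slow x\<^sub>0 constant_functions) e\<^sub>H hH"
    by (simp only: Higson_compactification_def)
  assume p: "p \<in> topspace (corona e\<^sub>H hH)"
  show "\<not> locally_connected_at p (corona e\<^sub>H hH)"
    by (rule corona_not_locally_connected_at[OF constant_functions_subset * _ p]) (rule proper)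
qed

end
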